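(* Let $X$ be a real Banach space, let $T:X\rightrightarrows X^*$ be a set-valued operator and let $\lambda>0$. Assume that $$\forall x\in X,\quad \operatorname{cl}\bigl(R(T(x+\cdot)+\lambda J)\bigr)=X^*.$$ Then, for every $\varepsilon\ge 0$ and every $(x,x^* )\in T^\varepsilon$ there exists a sequence $((x_n,x_n^* ))_n\subset T$ such that $$\lim_n\|x-x_n\|\le\sqrt{\lambda^{-1}\varepsilon}\quad\text{and}\quad\lim_n\|x^*-x_n^*\|\le\sqrt{\lambda\varepsilon}$$ (both limits existing). In short: $$\forall\varepsilon\ge 0,\quad T^\varepsilon\subset\operatorname{cl}\left(T+\sqrt{\lambda^{-1}\varepsilon}\,B_X\times\sqrt{\lambda\varepsilon}\,B_{X^*}\right).$$
   Context: $X$ is a real Banach space with closed unit ball $B_X$, $X^*$ its topological dual with closed unit ball $B_{X^*}$, and $\langle\cdot,\cdot\rangle$ the duality pairing. Set-valued operators $T:X\rightrightarrows X^*$ are identified with their graphs $T\subset X\times X^*$, so $x^*\in T(x)$ means $(x,x^* )\in T$. The range of $T$ is $R(T)=\{x^*\in X^*:\exists x\in X,\ x^*\in T(x)\}$. Sums of operators are pointwise: $(S+T)(y)=S(y)+T(y)$ (Minkowski sum, empty if one of the sets is empty), and $T(x+\cdot)$ is the operator $y\mapsto T(x+y)$. The duality operator $J:X\rightrightarrows X^*$ is $J(x)=\{x^*\in X^*:\langle x^*,x\rangle=\|x\|^2=\|x^*\|^2\}$. Closures are taken in the norm topology (norm$\times$norm topology in $X\times X^*$), and for $a,b\ge 0$,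 $T+aB_X\times bB_{X^*}$ denotes the Minkowski sum in $X\times X^*$ of the graph $T$ and the set $(aB_X)\times(bB_{X^*})$. For $\varepsilon\ge 0$, $$T^\varepsilon:=\{(x,x^* )\in X\times X^*: \langle y^*-x^*,y-x\rangle\ge-\varepsilon\ \text{ for all } (y,y^* )\in T\}.$$ *)

theory Defs
  imports "HOL-Analysis.Analysis" "HOL-Library.Set_Algebras"
begin

text \<open>
  The topological dual of a real Banach space \<open>'a\<close> is the type \<open>'a \<Rightarrow>\<^sub>L real\<close> of bounded linear
  functionals with the operator norm, and the duality pairing is \<open>blinfun_apply\<close>.
  An operator is identified with its graph, so \<open>T `` {x}\<close> is the value \<open>T(x)\<close> and
  \<open>Range T\<close> is the range \<open>R(T)\<close>. On sets, \<open>+\<close> is the Minkowski sum of \<open>HOL-Library.Set_Algebras\<close>.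
\<close>

type_synonym 'a dual = "'a \<Rightarrow>\<^sub>L real"

type_synonym 'a oper = "('a \<times> 'a dual) set"

definition oper_add :: "'a::real_normed_vector oper \<Rightarrow> 'a oper \<Rightarrow> 'a oper" where
  "oper_add S T = {(y, ys). ys \<in> S `` {y} + T `` {y}}"

definition oper_scale :: "real \<Rightarrow> 'a::real_normed_vector oper \<Rightarrow> 'a oper" where
  "oper_scale c T = {(y, ys). ys \<in> (\<lambda>v. c *\<^sub>R v) ` (T `` {y})}"

definition oper_shift :: "'a::real_normed_vector oper \<Rightarrow> 'a \<Rightarrow> 'a oper" where
  "oper_shift T x = {(y, ys). ys \<in> T `` {x + y}}"

definition duality_operator :: "'a::real_normed_vector oper" where
  "duality_operator =
     {(x, xs). blinfun_apply xs x = (norm x)\<^sup>2 \<and> (norm x)\<^sup>2 = (norm xs)\<^sup>2}"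

definition enlargement :: "'a::real_normed_vector oper \<Rightarrow> real \<Rightarrow> 'a oper" where
  "enlargement T \<epsilon> =
     {(x, xs). \<forall>(y, ys) \<in> T. blinfun_apply (ys - xs) (y - x) \<ge> - \<epsilon>}"

definition scaled_ball :: "real \<Rightarrow> 'b::real_normed_vector set" where
  "scaled_ball a = (\<lambda>u. a *\<^sub>R u) ` cball 0 1"

end

theory Submission
  imports Defs
begin

text \<open>
  Let \<open>(x, xs)\<close> belong to \<open>T\<^sup>\<epsilon>\<close>. Density of the range of \<open>T(x + \<cdot>) + \<lambda>J\<close> at the point \<open>xs\<close>
  provides, for every \<open>\<delta> > 0\<close>, some \<open>(u, us) \<in> T\<close> and \<open>zs \<in> J(u - x)\<close> with
  \<open>\<parallel>us + \<lambda> zs - xs\<parallel> < \<delta>\<close>. Up to the error \<open>\<delta>\<close>, the functional \<open>us - xs\<close> is thus \<open>-\<lambda> zs\<close>, and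
  since \<open>zs\<close> is dual to \<open>u - x\<close> this has two consequences:
  its norm is within \<open>\<delta>\<close> of \<open>\<lambda>\<parallel>u - x\<parallel>\<close>, and its value at \<open>u - x\<close> is at most
  \<open>\<delta>\<parallel>u - x\<parallel> - \<lambda>\<parallel>u - x\<parallel>\<^sup>2\<close>. That value is at least \<open>-\<epsilon>\<close> by membership in \<open>T\<^sup>\<epsilon>\<close>, so
  \<open>\<lambda>\<parallel>u - x\<parallel>\<^sup>2 \<le> \<epsilon> + \<delta>\<parallel>u - x\<parallel>\<close> (lemma \<open>enlargement_approx\<close>).

  Letting \<open>\<delta> \<rightarrow> 0\<close>, the distances \<open>\<parallel>u - x\<parallel>\<close> stay bounded and hence converge along a subsequence,
  to some \<open>l\<close> with \<open>\<lambda>l\<^sup>2 \<le> \<epsilon>\<close>. Along the same subsequence \<open>\<parallel>us - xs\<parallel>\<close> converges to \<open>\<lambda>l\<close>, and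
  \<open>l \<le> sqrt (\<epsilon>/\<lambda>)\<close> gives \<open>\<lambda>l \<le> sqrt (\<lambda>\<epsilon>)\<close>.

  The inclusion in the closure follows because a vector of norm just above \<open>r\<close> is close to
  the ball of radius \<open>r\<close> (lemma \<open>scaled_ball_near\<close>), applied to both components
  of \<open>(x, xs) - (u, us)\<close>.
\<close>

lemma enlargement_approx:
  fixes T :: "'a::real_normed_vector oper"
  assumes lam: "lam > 0"
    and dense: "closure (Range (oper_add (oper_shift T x) (oper_scale lam duality_operator)))
                  = (UNIV :: 'a dual set)"
    and enl: "(x, xs) \<in> enlargement T \<epsilon>"
    and "\<delta> > 0"
  shows "\<exists>u us. (u, us) \<in> T \<and> lam * (norm (x - u))\<^sup>2 \<le> \<epsilon> + \<delta> * norm (x - u)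
           \<and> \<bar>norm (xs - us) - lam * norm (x - u)\<bar> \<le> \<delta>"
proof -
  have "xs \<in> closure (Range (oper_add (oper_shift T x) (oper_scale lam duality_operator)))"
    using dense by simp
  then obtain w where w: "w \<in> Range (oper_add (oper_shift T x) (oper_scale lam duality_operator))"
    and "dist w xs < \<delta>"
    using \<open>\<delta> > 0\<close> unfolding closure_approachable by blast
  then obtain y us zs where w_eq: "w = us + lam *\<^sub>R zs" and T: "(x + y, us) \<in> T"
    and J: "(y, zs) \<in> duality_operator"
    by (auto simp: oper_add_def oper_shift_def oper_scale_def elim!: set_plus_elim)
  have zs_y: "blinfun_apply zs y = (norm y)\<^sup>2" and norm_zs: "norm zs = norm y"
    using J by (auto simp: duality_operator_def)
  define e where "e = us + lam *\<^sub>R zs - xs"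
  have e: "norm e \<le> \<delta>"
    using \<open>dist w xs < \<delta>\<close> by (simp add: e_def w_eq dist_norm)
  have us_xs: "us - xs = e - lam *\<^sub>R zs"
    by (simp add: e_def)
  have "- \<epsilon> \<le> blinfun_apply (us - xs) y"
    using enl T unfolding enlargement_def by fastforce
  also have "\<dots> = blinfun_apply e y - lam * (norm y)\<^sup>2"
    unfolding us_xs by (simp add: blinfun.diff_left blinfun.scaleR_left zs_y)
  also have "blinfun_apply e y \<le> norm e * norm y"
    using norm_blinfun[of e y] by simp
  also have "\<dots> \<le> \<delta> * norm y"
    using e by (simp add: mult_right_mono)
  finally have quad: "lam * (norm y)\<^sup>2 \<le> \<epsilon> + \<delta> * norm y"
    by simp
  have "xs - us = lam *\<^sub>R zs - e"
    using us_xs by (simp add: algebra_simps)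
  moreover have "norm (lam *\<^sub>R zs) = lam * norm y"
    using lam norm_zs by simp
  ultimately have "\<bar>norm (xs - us) - lam * norm y\<bar> \<le> \<delta>"
    using norm_triangle_ineq3[of "xs - us" "lam *\<^sub>R zs"] e by simp
  with T quad show ?thesis
    by (intro exI[of _ "x + y"] exI[of _ us]) simp
qed

lemma enlargement_sequence:
  fixes T :: "'a::real_normed_vector oper"
  assumes lam: "lam > 0"
    and dense: "closure (Range (oper_add (oper_shift T x) (oper_scale lam duality_operator)))
                  = (UNIV :: 'a dual set)"
    and enl: "(x, xs) \<in> enlargement T \<epsilon>"
    and "\<epsilon> \<ge> 0"
  shows "\<exists>u us l. (\<forall>n::nat. (u n, us n) \<in> T)
           \<and> (\<lambda>n. norm (x - u n)) \<longlonglongrightarrow> l \<and> l \<le> sqrt (inverse lam * \<epsilon>)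
           \<and> (\<lambda>n. norm (xs - us n)) \<longlonglongrightarrow> lam * l \<and> lam * l \<le> sqrt (lam * \<epsilon>)"
proof -
  define d where "d n = inverse (real (Suc n))" for n
  have d_pos: "d n > 0" and d_le: "d n \<le> 1" for n
    by (simp_all add: d_def field_simps)
  have d_lim: "d \<longlonglongrightarrow> 0"
    unfolding d_def by (rule LIMSEQ_inverse_real_of_nat)
  have "\<forall>n. \<exists>u us. (u, us) \<in> T \<and> lam * (norm (x - u))\<^sup>2 \<le> \<epsilon> + d n * norm (x - u)
           \<and> \<bar>norm (xs - us) - lam * norm (x - u)\<bar> \<le> d n"
    using enlargement_approx[OF lam dense enl d_pos] by blast
  then obtain v vs where T: "\<And>n. (v n, vs n) \<in> T"
    and quad: "\<And>n. lam * (norm (x - v n))\<^sup>2 \<le> \<epsilon> + d n * norm (x - v n)"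
    and dual: "\<And>n. \<bar>norm (xs - vs n) - lam * norm (x - v n)\<bar> \<le> d n"
    by metis
  define t where "t n = norm (x - v n)" for n
  have t_nonneg: "t n \<ge> 0" for n
    by (simp add: t_def)
  have t_le: "t n \<le> 1 + (\<epsilon> + 1) / lam" for n
  proof (cases "t n \<le> 1")
    case True
    then show ?thesis using lam \<open>\<epsilon> \<ge> 0\<close> by (simp add: add_increasing2)
  next
    case False
    \<comment> \<open>Since \<open>t n > 1\<close>, the right-hand side of the quadratic estimate is at most \<open>(\<epsilon> + 1) * t n\<close>.\<close>
    have "\<epsilon> \<le> \<epsilon> * t n"
      using False \<open>\<epsilon> \<ge> 0\<close> by (simp add: mult_le_cancel_left1)
    moreover have "d n * t n \<le> 1 * t n"
      using d_le t_nonneg by (intro mult_right_mono) auto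
    ultimately have "(lam * t n) * t n \<le> (\<epsilon> + 1) * t n"
      using quad[of n] by (simp add: t_def power2_eq_square algebra_simps)
    then have "lam * t n \<le> \<epsilon> + 1"
      using False by (simp add: mult_le_cancel_right)
    then have "t n \<le> (\<epsilon> + 1) / lam"
      using lam by (simp add: field_simps)
    then show ?thesis by simp
  qed
  have "bounded (range t)"
    using t_nonneg t_le by (intro boundedI[where B = "1 + (\<epsilon> + 1) / lam"]) auto
  then obtain l r where r: "strict_mono (r :: nat \<Rightarrow> nat)" and tr: "(t \<circ> r) \<longlonglongrightarrow> l"
    using bounded_imp_convergent_subsequence by blast
  have t_lim: "(\<lambda>n. t (r n)) \<longlonglongrightarrow> l"
    using tr by (simp add: o_def)
  have dr_lim: "(\<lambda>n. d (r n)) \<longlonglongrightarrow> 0"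
    using LIMSEQ_subseq_LIMSEQ[OF d_lim r] by (simp add: o_def)
  have l_nonneg: "l \<ge> 0"
    using t_lim t_nonneg by (intro LIMSEQ_le_const) auto
  have "lam * l\<^sup>2 \<le> \<epsilon> + 0 * l"
  proof (rule LIMSEQ_le)
    show "(\<lambda>n. lam * (t (r n))\<^sup>2) \<longlonglongrightarrow> lam * l\<^sup>2"
      by (intro tendsto_intros t_lim)
    show "(\<lambda>n. \<epsilon> + d (r n) * t (r n)) \<longlonglongrightarrow> \<epsilon> + 0 * l"
      by (intro tendsto_intros t_lim dr_lim)
  qed (use quad t_def in auto)
  then have l_sq: "lam * l\<^sup>2 \<le> \<epsilon>"
    by simp
  have l_le: "l \<le> sqrt (inverse lam * \<epsilon>)"
    using l_sq lam by (intro real_le_rsqrt) (simp add: field_simps)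
  have lam_l_le: "lam * l \<le> sqrt (lam * \<epsilon>)"
    using mult_left_mono[OF l_sq, of lam] lam
    by (intro real_le_rsqrt) (simp add: power2_eq_square algebra_simps)
  have "(\<lambda>n. norm (xs - vs (r n)) - lam * t (r n)) \<longlonglongrightarrow> 0"
    by (rule Lim_null_comparison[OF _ dr_lim]) (use dual t_def in auto)
  from tendsto_add[OF this tendsto_mult_left[OF t_lim, of lam]]
  have "(\<lambda>n. norm (xs - vs (r n))) \<longlonglongrightarrow> lam * l"
    by simp
  with T t_lim l_le lam_l_le show ?thesis
    unfolding t_def
    by (intro exI[of _ "\<lambda>n. v (r n)"] exI[of _ "\<lambda>n. vs (r n)"] exI[of _ l]) blast
qed

text \<open>
  Scaling by \<open>r / (r + e)\<close>, rather than projecting radially onto the ball, avoids distinguishing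
  vectors inside and outside the ball and also covers the degenerate ball \<open>r = 0\<close>.
\<close>

lemma scaled_ball_near:
  fixes v :: "'b::real_normed_vector"
  assumes "r \<ge> 0" "e > 0" "norm v < r + e"
  shows "\<exists>w\<in>scaled_ball r. norm (v - w) < e"
proof
  have re: "r + e > 0"
    using assms by simp
  show "r *\<^sub>R (inverse (r + e) *\<^sub>R v) \<in> scaled_ball r"
    unfolding scaled_ball_def using assms re by (intro imageI) (simp add: field_simps)
  have "v - r *\<^sub>R (inverse (r + e) *\<^sub>R v) = (1 - r * inverse (r + e)) *\<^sub>R v"
    by (simp add: algebra_simps)
  also have "1 - r * inverse (r + e) = e / (r + e)"
    using re by (simp add: field_simps)
  finally have "norm (v - r *\<^sub>R (inverse (r + e) *\<^sub>R v)) = e * (norm v / (r + e))"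
    using assms re by simp
  also have "\<dots> < e * 1"
    using assms re by (intro mult_strict_left_mono) (simp_all add: field_simps)
  finally show "norm (v - r *\<^sub>R (inverse (r + e) *\<^sub>R v)) < e"
    by simp
qed

lemma closure_plus_scaled_balls:
  fixes x :: "'a::real_normed_vector" and xs :: "'b::real_normed_vector"
  assumes "\<And>n::nat. (u n, us n) \<in> T"
    and "(\<lambda>n. norm (x - u n)) \<longlonglongrightarrow> l" "l \<le> a" "a \<ge> 0"
    and "(\<lambda>n. norm (xs - us n)) \<longlonglongrightarrow> m" "m \<le> b" "b \<ge> 0"
  shows "(x, xs) \<in> closure (T + scaled_ball a \<times> scaled_ball b)"
  unfolding closure_approachable
proof (intro allI impI)
  fix e :: real
  assume "e > 0"
  then have e2: "e / 2 > 0" by simp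
  have "\<forall>\<^sub>F n in sequentially. norm (x - u n) < a + e / 2"
    using assms(2,3) e2 by (intro order_tendstoD(2)) auto
  moreover have "\<forall>\<^sub>F n in sequentially. norm (xs - us n) < b + e / 2"
    using assms(5,6) e2 by (intro order_tendstoD(2)) auto
  ultimately have "\<forall>\<^sub>F n in sequentially. norm (x - u n) < a + e / 2 \<and> norm (xs - us n) < b + e / 2"
    by (rule eventually_conj)
  then obtain n where n: "norm (x - u n) < a + e / 2" "norm (xs - us n) < b + e / 2"
    using eventually_happens'[OF sequentially_bot] by blast
  obtain w where w: "w \<in> scaled_ball a" "norm (x - u n - w) < e / 2"
    using scaled_ball_near[OF \<open>a \<ge> 0\<close> e2 n(1)] by blast
  obtain ws where ws: "ws \<in> scaled_ball b" "norm (xs - us n - ws) < e / 2"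
    using scaled_ball_near[OF \<open>b \<ge> 0\<close> e2 n(2)] by blast
  have "(u n, us n) + (w, ws) \<in> T + scaled_ball a \<times> scaled_ball b"
    using assms(1) w ws by (intro set_plus_intro) auto
  moreover have "dist ((u n, us n) + (w, ws)) (x, xs) < e"
  proof -
    have "dist ((u n, us n) + (w, ws)) (x, xs) = norm (x - u n - w, xs - us n - ws)"
      using norm_minus_commute[of "(u n + w, us n + ws)" "(x, xs)"]
      by (simp add: dist_norm diff_diff_eq)
    also have "\<dots> \<le> norm (x - u n - w) + norm (xs - us n - ws)"
      by (rule norm_Pair_le)
    finally show ?thesis
      using w ws by simp
  qed
  ultimately show "\<exists>p\<in>T + scaled_ball a \<times> scaled_ball b. dist p (x, xs) < e"
    by blast
qed

theorem proposition2p3: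
  fixes T :: "'a::banach oper" and lam :: real
  assumes "lam > 0"
    and "\<forall>x::'a. closure (Range (oper_add (oper_shift T x) (oper_scale lam duality_operator)))
                   = (UNIV :: 'a dual set)"
  shows "(\<forall>\<epsilon>\<ge>0. \<forall>x xs. (x, xs) \<in> enlargement T \<epsilon> \<longrightarrow>
            (\<exists>(u :: nat \<Rightarrow> 'a) (us :: nat \<Rightarrow> 'a dual).
               (\<forall>n. (u n, us n) \<in> T) \<and>
               (\<exists>l. (\<lambda>n. norm (x - u n)) \<longlonglongrightarrow> l \<and> l \<le> sqrt (inverse lam * \<epsilon>)) \<and>
               (\<exists>m. (\<lambda>n. norm (xs - us n)) \<longlonglongrightarrow> m \<and> m \<le> sqrt (lam * \<epsilon>))))
       \<and> (\<forall>\<epsilon>\<ge>0. enlargement T \<epsilon> \<subseteq>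
            closure (T + scaled_ball (sqrt (inverse lam * \<epsilon>)) \<times> scaled_ball (sqrt (lam * \<epsilon>))))"
proof -
  note dense = assms(2)[rule_format]
  show ?thesis
  proof (intro conjI allI impI subsetI)
    fix \<epsilon> :: real and x :: 'a and xs :: "'a dual"
    assume "\<epsilon> \<ge> 0" "(x, xs) \<in> enlargement T \<epsilon>"
    then show "\<exists>(u :: nat \<Rightarrow> 'a) (us :: nat \<Rightarrow> 'a dual).
               (\<forall>n. (u n, us n) \<in> T) \<and>
               (\<exists>l. (\<lambda>n. norm (x - u n)) \<longlonglongrightarrow> l \<and> l \<le> sqrt (inverse lam * \<epsilon>)) \<and>
               (\<exists>m. (\<lambda>n. norm (xs - us n)) \<longlonglongrightarrow> m \<and> m \<le> sqrt (lam * \<epsilon>))"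
      using enlargement_sequence[OF \<open>lam > 0\<close> dense] by blast
  next
    fix \<epsilon> :: real and p :: "'a \<times> 'a dual"
    assume "\<epsilon> \<ge> 0" and p: "p \<in> enlargement T \<epsilon>"
    obtain x xs where p_eq: "p = (x, xs)"
      by (cases p)
    obtain u us l where "\<And>n::nat. (u n, us n) \<in> T"
      and "(\<lambda>n. norm (x - u n)) \<longlonglongrightarrow> l" "l \<le> sqrt (inverse lam * \<epsilon>)"
      and "(\<lambda>n. norm (xs - us n)) \<longlonglongrightarrow> lam * l" "lam * l \<le> sqrt (lam * \<epsilon>)"
      using enlargement_sequence[OF \<open>lam > 0\<close> dense p[unfolded p_eq] \<open>\<epsilon> \<ge> 0\<close>] by blast
    then show "p \<in> closure (T + scaled_ball (sqrt (inverse lam * \<epsilon>)) \<times> scaled_ball (sqrt (lam * \<epsilon>)))"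
      unfolding p_eq using \<open>lam > 0\<close> \<open>\<epsilon> \<ge> 0\<close> by (intro closure_plus_scaled_balls) auto
  qed
qed

end
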